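(* Let $\ell\ge m\ge n>0$ and let $\mathcal{A}=\sum_{i=1}^r\alpha_i\otimes\beta_i\otimes\gamma_i\in\mathbb{C}^{\ell+1}\otimes\mathbb{C}^{m+1}\otimes\mathbb{C}^{n+1}$ be a tensor of rank $r\le\min\{\ell+1,mn\}$ that is generic in the sense of the context. Assume in addition that $r\le m+1\le\ell+1$ and that the matrix $[\beta_1\ \cdots\ \beta_r]\in\mathbb{C}^{(m+1)\times r}$ has rank $r$. Let $I=\langle\ker\mathcal{A}_{(1)}\rangle\subset S$ and $\zeta_i=(\beta_i,\gamma_i)\in\mathbb{P}^m\times\mathbb{P}^n$. Let $h_0\in S_{(0,1)}$ be such that $h_0(\zeta_i)\ne0$ for $i=1,\dots,r$, and let $N:S_{(1,1)}\to\mathbb{C}^r$ be a pre-normal form on $S_{(1,1)}$, i.e., a $\mathbb{C}$-linear map with $\operatorname{rank}(N)=r$ and $\ker N=I_{(1,1)}$. For $g\in S_{(0,1)}$ define $\widetilde{N_g}:S_{(1,0)}\to\mathbb{C}^r$ by $\widetilde{N_g}(f)=N(gf)$. Then $\widetilde{N_{h_0}}$ has rank $r$. Moreover, for any $r$-dimensional subspace $B\subset S_{(1,0)}$ such that the restriction $(\widetilde{N_{h_0}})_{|B}:B\to\mathbb{C}^r$ is invertible, and any $j\in\{0,\dots,n\}$, the eigenvalues of $M_{y_j/h_0}=(\widetilde{N_{h_0}})_{|B}^{-1}\circ(\widetilde{N_{y_j}})_{|B}$ are $\{\gamma_{ij}/h_0(\zeta_i)\}_{i=1,\dots,r}$.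
   Context: $S=\mathbb{C}[x_0,\dots,x_m,y_0,\dots,y_n]=\bigoplus_{(d,e)\in\mathbb{N}^2}S_{(d,e)}$, with $S_{(d,e)}$ spanned by monomials of degree $d$ in $x$ and $e$ in $y$. For a homogeneous ideal $I$, $I_{(d,e)}=I\cap S_{(d,e)}$ and $V_X(I)$ is its zero set in $X=\mathbb{P}^m\times\mathbb{P}^n$. $\gamma_{ij}$ ($0\le j\le n$) denotes the $j$-th coordinate of $\gamma_i$, and $\gamma_{ij}/h_0(\zeta_i)$ is computed with the same homogeneous coordinates $\gamma_i$ in numerator and denominator. The flattening $\mathcal{A}_{(1)}=\sum_i\alpha_i(\beta_i\otimes\gamma_i)^\top$ is viewed as a linear map $S_{(1,1)}\to\mathbb{C}^{\ell+1}$ by identifying $e_k\otimes e_l$ with $x_ky_l$, so $\mathcal{A}_{(1)}(f)=\sum_i f(\beta_i,\gamma_i)\alpha_i$. Generic means: (i) $\mathcal{A}$ is $r$-identifiable (there is exactly one set of $r$ rank-1 tensors with sum $\mathcal{A}$); (ii) $\mathcal{A}_{(1)}$ has rank $r$; (iii) $V_X(I)=\{\zeta_1,\dots,\zeta_r\}$ for $I=\langle\ker\mathcal{A}_{(1)}\rangle$, and these are $r$ points of multiplicity one (the subscheme of $X$ defined by $I$ is reduced at each of them). *)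

theory Defs
  imports "HOL-Analysis.Analysis" "HOL-Library.Poly_Mapping"
begin

text \<open>
  The dimensions \<open>l + 1\<close>, \<open>m + 1\<close>, \<open>n + 1\<close> are the cardinalities of finite index types
  \<open>'l\<close>, \<open>'m\<close>, \<open>'n\<close>.  The polynomial ring \<open>S\<close> is the monoid algebra over \<open>complex\<close> of the monoid
  of exponent vectors \<open>'m + 'n \<Rightarrow>\<^sub>0 nat\<close>; the variable \<open>x k\<close> belongs to \<open>Inl k\<close> and \<open>y j\<close> to \<open>Inr j\<close>.
\<close>

type_synonym ('m, 'n) bipoly = "('m + 'n \<Rightarrow>\<^sub>0 nat) \<Rightarrow>\<^sub>0 complex"

definition pscale :: "complex \<Rightarrow> ('a \<Rightarrow>\<^sub>0 complex) \<Rightarrow> 'a \<Rightarrow>\<^sub>0 complex"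
  where "pscale c p = Poly_Mapping.map ((*) c) p"

lemma lookup_pscale [simp]: "Poly_Mapping.lookup (pscale c p) t = c * Poly_Mapping.lookup p t"
  by (simp add: pscale_def Poly_Mapping.map.rep_eq when_def)

text \<open>
  This interpretation serves both for \<open>S\<close> and for the target spaces \<open>cspace r\<close> below.
\<close>

global_interpretation pm: vector_space pscale
  by unfold_locales (auto intro!: poly_mapping_eqI simp: Poly_Mapping.lookup_add algebra_simps)

text \<open>The space \<open>\<complex>\<^sup>r\<close> with coordinates indexed by \<open>1, \<dots>, r\<close>; here \<open>r = 0\<close> is allowed.\<close>

definition cspace :: "nat \<Rightarrow> (nat \<Rightarrow>\<^sub>0 complex) set"
  where "cspace r = {v. Poly_Mapping.keys v \<subseteq> {1..r}}"

definition linear_map_on ::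
    "('a \<Rightarrow>\<^sub>0 complex) set \<Rightarrow> ('b \<Rightarrow>\<^sub>0 complex) set \<Rightarrow> (('a \<Rightarrow>\<^sub>0 complex) \<Rightarrow> ('b \<Rightarrow>\<^sub>0 complex)) \<Rightarrow> bool"
  where "linear_map_on V W T \<longleftrightarrow>
    (\<forall>v\<in>V. T v \<in> W) \<and>
    (\<forall>v\<in>V. \<forall>w\<in>V. T (v + w) = T v + T w) \<and>
    (\<forall>c. \<forall>v\<in>V. T (pscale c v) = pscale c (T v))"

definition rank_on :: "('a \<Rightarrow>\<^sub>0 complex) set \<Rightarrow> (('a \<Rightarrow>\<^sub>0 complex) \<Rightarrow> ('b \<Rightarrow>\<^sub>0 complex)) \<Rightarrow> nat"
  where "rank_on V T = pm.dim (T ` V)"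

text \<open>In the next two definitions, \<open>T\<close> is an endomorphism of the subspace \<open>V\<close>.\<close>

definition eigenvalues_on :: "('a \<Rightarrow>\<^sub>0 complex) set \<Rightarrow> (('a \<Rightarrow>\<^sub>0 complex) \<Rightarrow> ('a \<Rightarrow>\<^sub>0 complex)) \<Rightarrow> complex set"
  where "eigenvalues_on V T = {c. \<exists>v\<in>V. v \<noteq> 0 \<and> T v = pscale c v}"

text \<open>Algebraic multiplicity: the dimension of the generalized eigenspace.\<close>

definition alg_mult_on ::
    "('a \<Rightarrow>\<^sub>0 complex) set \<Rightarrow> (('a \<Rightarrow>\<^sub>0 complex) \<Rightarrow> ('a \<Rightarrow>\<^sub>0 complex)) \<Rightarrow> complex \<Rightarrow> nat"
  where "alg_mult_on V T c = pm.dim {v \<in> V. \<exists>k::nat. ((\<lambda>w. T w - pscale c w) ^^ k) v = 0}"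


subsection \<open>The bigraded ring\<close>

definition bidegree :: "('m::finite + 'n::finite \<Rightarrow>\<^sub>0 nat) \<Rightarrow> nat \<times> nat"
  where "bidegree t = (\<Sum>k\<in>UNIV. Poly_Mapping.lookup t (Inl k), \<Sum>j\<in>UNIV. Poly_Mapping.lookup t (Inr j))"

definition bihom :: "nat \<Rightarrow> nat \<Rightarrow> ('m::finite, 'n::finite) bipoly set"
  where "bihom d e = pm.span {Poly_Mapping.single t 1 |t. bidegree t = (d, e)}"

definition yvar :: "'n \<Rightarrow> ('m::finite, 'n::finite) bipoly"
  where "yvar j = Poly_Mapping.single (Poly_Mapping.single (Inr j) 1) 1"

definition bieval :: "('m::finite, 'n::finite) bipoly \<Rightarrow> complex ^ 'm \<Rightarrow> complex ^ 'n \<Rightarrow> complex"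
  where "bieval f u v =
    (\<Sum>t\<in>Poly_Mapping.keys f. Poly_Mapping.lookup f t *
      (\<Prod>k\<in>UNIV. (u $ k) ^ Poly_Mapping.lookup t (Inl k)) *
      (\<Prod>j\<in>UNIV. (v $ j) ^ Poly_Mapping.lookup t (Inr j)))"

definition ideal_gen :: "('m::finite, 'n::finite) bipoly set \<Rightarrow> ('m, 'n) bipoly set"
  where "ideal_gen F = module.span (*) F"

text \<open>A point of projective space is the line spanned by a vector of homogeneous coordinates.\<close>

definition bipoint ::
    "complex ^ 'm \<Rightarrow> complex ^ 'n \<Rightarrow> (complex ^ 'm::finite) set \<times> (complex ^ 'n::finite) set"
  where "bipoint u v = (vec.span {u}, vec.span {v})"

definition zero_set ::
    "('m, 'n) bipoly set \<Rightarrow> ((complex ^ 'm::finite) set \<times> (complex ^ 'n::finite) set) set"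
  where "zero_set I = {bipoint u v |u v. u \<noteq> 0 \<and> v \<noteq> 0 \<and> (\<forall>f\<in>I. bieval f u v = 0)}"

text \<open>
  The local ring at the point \<open>(u, v)\<close> of the subscheme of \<open>\<P>\<^sup>m \<times> \<P>\<^sup>n\<close> defined by a bihomogeneous ideal
  \<open>I\<close> consists of the fractions \<open>f/g\<close> with \<open>f\<close> and \<open>g\<close> bihomogeneous of the same bidegree and
  \<open>g(u, v) \<noteq> 0\<close>, i.e., of the bidegree-\<open>(0, 0)\<close> part of the homogeneous localization of \<open>S/I\<close>.
\<close>

definition local_fractions ::
    "complex ^ 'm::finite \<Rightarrow> complex ^ 'n::finite \<Rightarrow> (('m, 'n) bipoly \<times> ('m, 'n) bipoly) set"
  where "local_fractions u v =
    {(f, g). \<exists>d e. f \<in> bihom d e \<and> g \<in> bihom d e \<and> bieval g u v \<noteq> 0}"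

definition local_eq ::
    "('m, 'n) bipoly set \<Rightarrow> complex ^ 'm::finite \<Rightarrow> complex ^ 'n::finite \<Rightarrow>
      ('m, 'n) bipoly \<times> ('m, 'n) bipoly \<Rightarrow> ('m, 'n) bipoly \<times> ('m, 'n) bipoly \<Rightarrow> bool"
  where "local_eq I u v a b \<longleftrightarrow>
    (\<exists>d e. \<exists>h\<in>bihom d e. bieval h u v \<noteq> 0 \<and> h * (fst a * snd b - fst b * snd a) \<in> I)"

text \<open>The local ring has no nonzero nilpotent elements.\<close>

definition reduced_at ::
    "('m, 'n) bipoly set \<Rightarrow> complex ^ 'm::finite \<Rightarrow> complex ^ 'n::finite \<Rightarrow> bool"
  where "reduced_at I u v \<longleftrightarrow>
    (\<forall>(f, g)\<in>local_fractions u v. \<forall>k::nat.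
      local_eq I u v (f ^ k, g ^ k) (0, 1) \<longrightarrow> local_eq I u v (f, g) (0, 1))"


subsection \<open>Tensors\<close>

definition outer :: "complex ^ 'l \<Rightarrow> complex ^ 'm \<Rightarrow> complex ^ 'n \<Rightarrow> complex ^ 'n ^ 'm ^ 'l"
  where "outer a b c = (\<chi> i k j. a $ i * b $ k * c $ j)"

definition rank_one_tensors :: "(complex ^ 'n::finite ^ 'm::finite ^ 'l::finite) set"
  where "rank_one_tensors = {outer a b c |a b c. a \<noteq> 0 \<and> b \<noteq> 0 \<and> c \<noteq> 0}"

definition tensor_rank :: "complex ^ 'n::finite ^ 'm::finite ^ 'l::finite \<Rightarrow> nat"
  where "tensor_rank A = (LEAST r. \<exists>a b c. A = (\<Sum>i=1..r. outer (a i) (b i) (c i)))"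

definition identifiable :: "nat \<Rightarrow> complex ^ 'n::finite ^ 'm::finite ^ 'l::finite \<Rightarrow> bool"
  where "identifiable r A \<longleftrightarrow>
    (\<exists>!T. T \<subseteq> rank_one_tensors \<and> finite T \<and> card T = r \<and> \<Sum>T = A)"

text \<open>
  The flattening in the first mode as a map on \<open>S\<^sub>1\<^sub>,\<^sub>1\<close>, where \<open>e\<^sub>k \<otimes> e\<^sub>j\<close> is identified with the monomial
  \<open>x\<^sub>k y\<^sub>j\<close>.  It only looks at coefficients of such monomials.
\<close>

definition flattening ::
    "complex ^ 'n::finite ^ 'm::finite ^ 'l::finite \<Rightarrow> ('m, 'n) bipoly \<Rightarrow> complex ^ 'l"
  where "flattening A f = (\<chi> i. \<Sum>k\<in>UNIV. \<Sum>j\<in>UNIV.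
    A $ i $ k $ j * Poly_Mapping.lookup f (Poly_Mapping.single (Inl k) 1 + Poly_Mapping.single (Inr j) 1))"

definition flattening_ker ::
    "complex ^ 'n::finite ^ 'm::finite ^ 'l::finite \<Rightarrow> ('m, 'n) bipoly set"
  where "flattening_ker A = {f \<in> bihom 1 1. flattening A f = 0}"


subsection \<open>Pre-normal forms\<close>

definition pre_normal_form ::
    "nat \<Rightarrow> ('m::finite, 'n::finite) bipoly set \<Rightarrow> (('m, 'n) bipoly \<Rightarrow> (nat \<Rightarrow>\<^sub>0 complex)) \<Rightarrow> bool"
  where "pre_normal_form r I N \<longleftrightarrow>
    linear_map_on (bihom 1 1) (cspace r) N \<and>
    rank_on (bihom 1 1) N = r \<and>
    {f \<in> bihom 1 1. N f = 0} = I \<inter> bihom 1 1"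

text \<open>To be used on \<open>bihom 1 0\<close>, for \<open>g \<in> bihom 0 1\<close>.\<close>

definition N_tilde ::
    "(('m::finite, 'n::finite) bipoly \<Rightarrow> (nat \<Rightarrow>\<^sub>0 complex)) \<Rightarrow> ('m, 'n) bipoly \<Rightarrow> ('m, 'n) bipoly \<Rightarrow> (nat \<Rightarrow>\<^sub>0 complex)"
  where "N_tilde N g f = N (g * f)"

end

theory Submission
  imports Defs
begin

text \<open>
  Since the flattening \<open>A\<^sub>1 f = \<Sum>\<^sub>i f(\<zeta>\<^sub>i) \<alpha>\<^sub>i\<close> has rank \<open>r\<close>, the \<open>\<alpha>\<^sub>i\<close> are linearly independent, so
  \<open>I\<^sub>1\<^sub>1\<close> consists of the forms vanishing at all \<open>\<zeta>\<^sub>i\<close>.  Independence of the \<open>\<beta>\<^sub>i\<close> provides linear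
  forms \<open>L\<^sub>i\<close> in \<open>x\<close> with \<open>L\<^sub>i(\<beta>\<^sub>k) = \<delta>\<^sub>i\<^sub>k\<close>, and comparing values at the \<open>\<zeta>\<^sub>i\<close> gives
  \<open>N(g f) = \<Sum>\<^sub>i f(\<beta>\<^sub>i) g(\<gamma>\<^sub>i) / h\<^sub>0(\<zeta>\<^sub>i) w\<^sub>i\<close> with the independent vectors \<open>w\<^sub>i = N(h\<^sub>0 L\<^sub>i)\<close>.  Hence the
  preimages of the \<open>w\<^sub>i\<close> in \<open>B\<close> form a basis of eigenvectors of \<open>M\<close>.
\<close>

section \<open>Linear algebra of indexed families\<close>

lemma (in vector_space) sum_family_eq_0:
  assumes "inj_on f J" "independent (f ` J)" "finite J" "(\<Sum>i\<in>J. scale (c i) (f i)) = 0" "i \<in> J"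
  shows "c i = 0"
proof -
  have "(\<Sum>v\<in>f ` J. scale (c (inv_into J f v)) v) = 0"
    using assms by (simp add: sum.reindex)
  then have "c (inv_into J f (f i)) = 0"
    using assms by (intro independentD[of "f ` J" "f ` J" "\<lambda>v. c (inv_into J f v)"]) auto
  then show ?thesis
    using assms by simp
qed

text \<open>A repeated vector \<open>f i = f k\<close> would give the nontrivial relation
  \<open>f i - f k = 0\<close>, so the condition on coefficients forces injectivity; after that, a
  relation on the image set pulls back along \<open>f\<close>.\<close>

lemma (in vector_space) independent_familyI:
  assumes "finite J" and ind: "\<And>c i. (\<Sum>i\<in>J. scale (c i) (f i)) = 0 \<Longrightarrow> i \<in> J \<Longrightarrow> c i = 0"
  shows "inj_on f J" "independent (f ` J)"
proof -
  show inj: "inj_on f J"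
  proof (rule inj_onI, rule ccontr)
    fix i k assume ik: "i \<in> J" "k \<in> J" "f i = f k" "i \<noteq> k"
    define c where "c j = (if j = i then 1 else if j = k then - 1 else 0 :: 'a)" for j
    have "(\<Sum>j\<in>J. scale (c j) (f j)) = (\<Sum>j\<in>{i, k}. scale (c j) (f j))"
      using ik \<open>finite J\<close> by (intro sum.mono_neutral_right) (auto simp: c_def)
    also have "\<dots> = 0"
      using ik by (simp add: c_def)
    finally show False
      using ind[of c i] ik by (simp add: c_def)
  qed
  show "independent (f ` J)"
  proof (rule independent_if_scalars_zero)
    fix c v assume "(\<Sum>x\<in>f ` J. scale (c x) x) = 0" "v \<in> f ` J"
    then show "c v = 0"
      using ind[of "\<lambda>i. c (f i)"] inj by (auto simp: sum.reindex)
  qed (use \<open>finite J\<close> in simp)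
qed

text \<open>Coefficients are indexed by \<open>J\<close> and not by vectors, so this form needs no
  injectivity of \<open>f\<close>.\<close>

lemma (in vector_space) span_family:
  assumes "finite J"
  shows "span (f ` J) = range (\<lambda>c. \<Sum>i\<in>J. scale (c i) (f i))"
proof
  show "span (f ` J) \<subseteq> range (\<lambda>c. \<Sum>i\<in>J. scale (c i) (f i))"
  proof (rule span_minimal)
    show "f ` J \<subseteq> range (\<lambda>c. \<Sum>i\<in>J. scale (c i) (f i))"
    proof clarify
      fix i assume "i \<in> J"
      then have "f i = (\<Sum>k\<in>J. scale (if k = i then 1 else 0) (f k))"
        using assms by (simp add: if_distrib[of "\<lambda>x. scale x _"] cong: if_cong)
      then show "f i \<in> range (\<lambda>c. \<Sum>i\<in>J. scale (c i) (f i))"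
        by (rule image_eqI[of _ _ "\<lambda>k. if k = i then 1 else 0"]) simp
    qed
    show "subspace (range (\<lambda>c. \<Sum>i\<in>J. scale (c i) (f i)))"
    proof (rule subspaceI)
      show "0 \<in> range (\<lambda>c. \<Sum>i\<in>J. scale (c i) (f i))"
        by (rule image_eqI[of _ _ "\<lambda>_. 0"]) simp_all
    next
      fix x y assume "x \<in> range (\<lambda>c. \<Sum>i\<in>J. scale (c i) (f i))" "y \<in> range (\<lambda>c. \<Sum>i\<in>J. scale (c i) (f i))"
      then obtain c d where "x = (\<Sum>i\<in>J. scale (c i) (f i))" "y = (\<Sum>i\<in>J. scale (d i) (f i))" by auto
      then have "x + y = (\<Sum>i\<in>J. scale (c i + d i) (f i))"
        by (simp add: scale_left_distrib sum.distrib)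
      then show "x + y \<in> range (\<lambda>c. \<Sum>i\<in>J. scale (c i) (f i))"
        by (auto intro!: image_eqI[of _ _ "\<lambda>i. c i + d i"])
    next
      fix a x assume "x \<in> range (\<lambda>c. \<Sum>i\<in>J. scale (c i) (f i))"
      then obtain c where "x = (\<Sum>i\<in>J. scale (c i) (f i))" by auto
      then have "scale a x = (\<Sum>i\<in>J. scale (a * c i) (f i))"
        by (simp add: scale_sum_right)
      then show "scale a x \<in> range (\<lambda>c. \<Sum>i\<in>J. scale (c i) (f i))"
        by (auto intro!: image_eqI[of _ _ "\<lambda>i. a * c i"])
    qed
  qed
  show "range (\<lambda>c. \<Sum>i\<in>J. scale (c i) (f i)) \<subseteq> span (f ` J)"
    by (intro image_subsetI span_sum span_scale span_base imageI)
qed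

lemma (in vector_space) dim_span_family:
  assumes "finite J" "\<And>c i. (\<Sum>i\<in>J. scale (c i) (f i)) = 0 \<Longrightarrow> i \<in> J \<Longrightarrow> c i = 0"
  shows "dim (span (f ` J)) = card J"
proof -
  have "inj_on f J" "independent (f ` J)"
    by (rule independent_familyI; fact)+
  then show ?thesis
    by (simp add: dim_eq_card_independent card_image)
qed

text \<open>In general \<open>dim (f\<close> J) \<le> card (f \<open>J) \<le> card J\<close>. The
  hypothesis turns both into equalities: nothing is repeated, and the image is a spanning set of its
  span of minimal size.\<close>

lemma (in finite_dimensional_vector_space) family_independent_of_dim:
  assumes "finite J" "card J \<le> dim (f ` J)"
  shows "inj_on f J" "independent (f ` J)"
proof -
  have "dim (f ` J) \<le> card (f ` J)"
    using assms(1) by (intro dim_le_card) (auto simp: span_base)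
  then have eq: "card (f ` J) = card J" and le: "card (f ` J) \<le> dim (f ` J)"
    using card_image_le[OF assms(1), of f] assms(2) by linarith+
  show "inj_on f J"
    using eq assms(1) by (simp add: eq_card_imp_inj_on)
  show "independent (f ` J)"
    by (rule card_le_dim_spanning[OF subset_refl]) (use assms(1) le in \<open>auto simp: span_base\<close>)
qed

section \<open>Spectrum of a diagonalizable endomorphism\<close>

text \<open>In coordinates with respect to \<open>b\<close>, the map \<open>T - e\<close> multiplies
  the \<open>i\<close>-th coordinate by \<open>ev i - e\<close>. A power of it can kill only vectors
  whose coordinates with \<open>ev i \<noteq> e\<close> vanish, so the generalized eigenspace is
  spanned by the remaining \<open>b i\<close>.\<close>

lemma spectrum_diagonal:
  fixes b :: "'i \<Rightarrow> ('a \<Rightarrow>\<^sub>0 complex)"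
  assumes fin: "finite J"
    and ind: "\<And>c i. (\<Sum>i\<in>J. pscale (c i) (b i)) = 0 \<Longrightarrow> i \<in> J \<Longrightarrow> c i = 0"
    and B: "B = range (\<lambda>c. \<Sum>i\<in>J. pscale (c i) (b i))"
    and T: "\<And>c. T (\<Sum>i\<in>J. pscale (c i) (b i)) = (\<Sum>i\<in>J. pscale (ev i * c i) (b i))"
  shows "eigenvalues_on B T = ev ` J"
    and "alg_mult_on B T e = card {i \<in> J. ev i = e}"
proof -
  define C where "C c = (\<Sum>i\<in>J. pscale (c i) (b i))" for c
  have C_diff: "C c - C d = C (\<lambda>i. c i - d i)" for c d
    by (simp add: C_def pm.scale_left_diff_distrib sum_subtractf)
  have C_scale: "pscale a (C c) = C (\<lambda>i. a * c i)" for a c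
    by (simp add: C_def pm.scale_sum_right)
  have C_0: "C c = 0 \<longleftrightarrow> (\<forall>i\<in>J. c i = 0)" for c
    using ind[of c] by (auto simp: C_def)
  have C_eq: "C c = C d \<longleftrightarrow> (\<forall>i\<in>J. c i = d i)" for c d
    using C_0[of "\<lambda>i. c i - d i"] C_diff[of c d] by auto
  have T_C: "T (C c) = C (\<lambda>i. ev i * c i)" for c
    using T by (simp add: C_def)
  have B_C: "B = range C"
    using B by (simp add: C_def fun_eq_iff)
  show "eigenvalues_on B T = ev ` J"
  proof (intro equalityI subsetI)
    fix a assume "a \<in> eigenvalues_on B T"
    then obtain c where "C c \<noteq> 0" "T (C c) = pscale a (C c)"
      by (auto simp: eigenvalues_on_def B_C)
    then obtain i where "i \<in> J" "c i \<noteq> 0" "ev i * c i = a * c i"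
      by (auto simp: C_0 T_C C_scale C_eq)
    then show "a \<in> ev ` J" by auto
  next
    fix a assume "a \<in> ev ` J"
    then obtain i where i: "i \<in> J" "a = ev i" by auto
    \<comment> \<open>This vector is \<open>b i\<close> itself, written in coordinates.\<close>
    have "C (\<lambda>k. if k = i then 1 else 0) \<in> B \<and> C (\<lambda>k. if k = i then 1 else 0) \<noteq> 0 \<and>
        T (C (\<lambda>k. if k = i then 1 else 0)) = pscale a (C (\<lambda>k. if k = i then 1 else 0))"
      using i by (auto simp: B_C C_0 T_C C_scale C_eq)
    then show "a \<in> eigenvalues_on B T"
      unfolding eigenvalues_on_def by blast
  qed
  let ?J = "{i \<in> J. ev i = e}"
  have pow: "((\<lambda>w. T w - pscale e w) ^^ k) (C c) = C (\<lambda>i. (ev i - e) ^ k * c i)" for k c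
    by (induction k) (simp_all add: T_C C_scale C_diff algebra_simps)
  have restrict: "C c = (\<Sum>i\<in>?J. pscale (c i) (b i))" if "\<forall>i\<in>J. ev i \<noteq> e \<longrightarrow> c i = 0" for c
    unfolding C_def using that fin by (intro sum.mono_neutral_right) auto
  have "{v \<in> B. \<exists>k::nat. ((\<lambda>w. T w - pscale e w) ^^ k) v = 0} = pm.span (b ` ?J)"
  proof (intro equalityI subsetI)
    fix v assume "v \<in> {v \<in> B. \<exists>k::nat. ((\<lambda>w. T w - pscale e w) ^^ k) v = 0}"
    then obtain c k where v: "v = C c" "\<forall>i\<in>J. (ev i - e) ^ k * c i = 0"
      by (auto simp: B_C pow C_0)
    then have "v = (\<Sum>i\<in>?J. pscale (c i) (b i))"
      by (auto intro!: restrict)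
    then show "v \<in> pm.span (b ` ?J)"
      using pm.span_family[of ?J b] fin by simp
  next
    fix v assume "v \<in> pm.span (b ` ?J)"
    then obtain c where c: "v = (\<Sum>i\<in>?J. pscale (c i) (b i))"
      using pm.span_family[of ?J b] fin by auto
    \<comment> \<open>Extends the coefficients by zero from \<open>?J\<close> to \<open>J\<close>,
      which puts the vector in the form \<open>C d\<close>.\<close>
    define d where "d i = (if ev i = e then c i else 0)" for i
    have "C d = (\<Sum>i\<in>?J. pscale (d i) (b i))"
      by (rule restrict) (simp add: d_def)
    then have "v = C d"
      by (simp add: c d_def)
    \<comment> \<open>The exponent 1 suffices, since \<open>T\<close> is diagonal.\<close>
    moreover have "((\<lambda>w. T w - pscale e w) ^^ 1) (C d) = 0"
      unfolding pow by (simp add: C_0 d_def)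
    ultimately show "v \<in> {v \<in> B. \<exists>k::nat. ((\<lambda>w. T w - pscale e w) ^^ k) v = 0}"
      unfolding B_C by blast
  qed
  moreover have "pm.dim (pm.span (b ` ?J)) = card ?J"
  proof (rule pm.dim_span_family)
    fix c i assume c: "(\<Sum>i\<in>?J. pscale (c i) (b i)) = 0" and i: "i \<in> ?J"
    define d where "d i = (if ev i = e then c i else 0)" for i
    have "C d = (\<Sum>i\<in>?J. pscale (d i) (b i))"
      by (rule restrict) (simp add: d_def)
    then show "c i = 0"
      using c i by (auto simp: C_0 d_def)
  qed (use fin in simp)
  ultimately show "alg_mult_on B T e = card ?J"
    by (simp add: alg_mult_on_def)
qed

section \<open>Evaluation of polynomials\<close>

lemma poly_mapping_sum_single: "p = (\<Sum>t\<in>Poly_Mapping.keys p. Poly_Mapping.single t (Poly_Mapping.lookup p t))"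
  by (rule poly_mapping_eqI)
    (auto simp: Poly_Mapping.lookup_sum lookup_single when_def in_keys_iff)

text \<open>Reduces scaling to multiplication by a constant polynomial, so that ring laws and
  multiplicativity of evaluation apply to it.\<close>

lemma pscale_eq_times: "pscale c p = Poly_Mapping.single 0 c * (p :: ('a::comm_monoid_add) \<Rightarrow>\<^sub>0 complex)"
proof -
  have "Poly_Mapping.single 0 c * p
      = (\<Sum>t\<in>Poly_Mapping.keys p. Poly_Mapping.single t (c * Poly_Mapping.lookup p t))"
    by (subst poly_mapping_sum_single[of p]) (simp add: sum_distrib_left mult_single)
  also have "\<dots> = pscale c p"
    by (rule poly_mapping_eqI)
      (auto simp: Poly_Mapping.lookup_sum lookup_single when_def in_keys_iff)
  finally show ?thesis ..
qed

text \<open>Allows a common index set for several polynomials; cancellation can make the keys of a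
  sum smaller than the union of the keys.\<close>

lemma bieval_superset:
  assumes "finite K" "Poly_Mapping.keys f \<subseteq> K"
  shows "bieval f u v = (\<Sum>t\<in>K. Poly_Mapping.lookup f t *
      (\<Prod>k\<in>UNIV. (u $ k) ^ Poly_Mapping.lookup t (Inl k)) *
      (\<Prod>j\<in>UNIV. (v $ j) ^ Poly_Mapping.lookup t (Inr j)))"
  unfolding bieval_def using assms by (intro sum.mono_neutral_left) (auto simp: in_keys_iff)

lemma bieval_0 [simp]: "bieval 0 u v = 0"
  by (simp add: bieval_def)

lemma bieval_add: "bieval (f + g) u v = bieval f u v + bieval g u v"
proof -
  let ?K = "Poly_Mapping.keys f \<union> Poly_Mapping.keys g"
  show ?thesis
    using Poly_Mapping.keys_add[of f g]
    by (simp add: bieval_superset[of ?K] lookup_add distrib_right sum.distrib)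
qed

lemma bieval_sum: "bieval (sum f J) u v = (\<Sum>i\<in>J. bieval (f i) u v)"
  by (induction J rule: infinite_finite_induct) (auto simp: bieval_add)

lemma bieval_single: "bieval (Poly_Mapping.single t c) u v = c *
      (\<Prod>k\<in>UNIV. (u $ k) ^ Poly_Mapping.lookup t (Inl k)) *
      (\<Prod>j\<in>UNIV. (v $ j) ^ Poly_Mapping.lookup t (Inr j))"
  by (subst bieval_superset[of "{t}"]) auto

text \<open>Exponents of monomials add, which settles products of monomials; the rest is
  bilinearity, first in \<open>f\<close> and then in \<open>g\<close>.\<close>

lemma bieval_times: "bieval (f * g) u v = bieval f u v * bieval g u v"
proof -
  have "bieval (Poly_Mapping.single s a * Poly_Mapping.single t b) u v
      = bieval (Poly_Mapping.single s a) u v * bieval (Poly_Mapping.single t b) u v" for s t a b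
    by (simp add: mult_single bieval_single lookup_add power_add prod.distrib)
  then have "bieval (f * Poly_Mapping.single t b) u v = bieval f u v * bieval (Poly_Mapping.single t b) u v" for t b
    by (subst (1 2) poly_mapping_sum_single[of f]) (simp add: sum_distrib_right bieval_sum)
  then show ?thesis
    by (subst (1 2) poly_mapping_sum_single[of g]) (simp add: sum_distrib_left bieval_sum)
qed

lemma bieval_pscale: "bieval (pscale c f) u v = c * bieval f u v"
  by (simp add: pscale_eq_times bieval_times bieval_single)

section \<open>Bihomogeneous forms\<close>

lemma subspace_bihom: "pm.subspace (bihom d e)"
  by (simp add: bihom_def)

lemma single_in_bihom: "bidegree t = (d, e) \<Longrightarrow> Poly_Mapping.single t 1 \<in> bihom d e"
  by (auto simp: bihom_def intro!: pm.span_base)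

lemma bihom_times:
  assumes "f \<in> bihom d e" "g \<in> bihom d' e'"
  shows "f * g \<in> bihom (d + d') (e + e')"
proof -
  have mono: "Poly_Mapping.single s 1 * Poly_Mapping.single t 1 \<in> bihom (d + d') (e + e')"
    if "bidegree s = (d, e)" "bidegree t = (d', e')" for s t
    using that by (auto simp: mult_single bidegree_def lookup_add sum.distrib intro!: single_in_bihom)
  have sub: "pm.subspace {f. f * h \<in> bihom (d + d') (e + e')}" for h
    using subspace_bihom[of "d + d'" "e + e'"]
    by (auto intro!: pm.subspaceI simp: distrib_right pscale_eq_times mult.assoc pm.subspace_def)
  have left: "f * Poly_Mapping.single t 1 \<in> bihom (d + d') (e + e')" if "bidegree t = (d', e')" for t
    using assms(1) unfolding bihom_def[of d e]
    by (rule pm.span_induct) (auto simp: mono[OF _ that] intro: sub)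
  show ?thesis
    using assms(2) unfolding bihom_def[of d' e']
  proof (rule pm.span_induct)
    show "pm.subspace {g. f * g \<in> bihom (d + d') (e + e')}"
      using sub[of f] by (simp add: mult.commute)
  qed (auto simp: left)
qed

text \<open>By independence, prescribed values on the \<open>\<beta> k\<close> extend to a linear
  map on the whole space, and a row of its matrix supplies the coefficients of \<open>L i\<close>.
  Only \<open>x\<close>-variables occur, so \<open>v\<close> is arbitrary.\<close>

lemma dual_linear_forms:
  fixes \<beta> :: "'i \<Rightarrow> complex ^ 'm::finite"
  assumes "inj_on \<beta> J" "vec.independent (\<beta> ` J)"
  obtains L :: "'i \<Rightarrow> ('m, 'n::finite) bipoly"
  where "\<And>i. L i \<in> bihom 1 0"
    and "\<And>i k v. i \<in> J \<Longrightarrow> k \<in> J \<Longrightarrow> bieval (L i) (\<beta> k) v = (if i = k then 1 else 0)"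
proof -
  have "\<exists>g. Vector_Spaces.linear (*s) (*s) g \<and>
      (\<forall>x\<in>\<beta> ` J. g x = (if x = \<beta> i then 1 else 0 :: complex ^ 'm))" for i
    by (rule vec.linear_independent_extend[OF assms(2)])
  then obtain g where lin: "Vector_Spaces.linear (*s) (*s) (g i)"
    and g: "x \<in> \<beta> ` J \<Longrightarrow> g i x = (if x = \<beta> i then 1 else 0 :: complex ^ 'm)" for i x
    by metis
  \<comment> \<open>\<open>g i\<close> is vector-valued; any of its coordinates serves as the dual functional.\<close>
  fix q :: 'm
  define var :: "'m \<Rightarrow> ('m, 'n) bipoly"
    where "var k = Poly_Mapping.single (Poly_Mapping.single (Inl k) 1) 1" for k
  define L :: "'i \<Rightarrow> ('m, 'n) bipoly"
    where "L i = (\<Sum>k\<in>UNIV. pscale (matrix (g i) $ q $ k) (var k))" for i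
  have "var k \<in> bihom 1 0" for k
    unfolding var_def by (rule single_in_bihom) (simp add: bidegree_def lookup_single when_def)
  then have "L i \<in> bihom 1 0" for i
    unfolding L_def by (intro pm.subspace_sum pm.subspace_scale subspace_bihom)
  moreover have "bieval (var k) u v = u $ k" for k u v
    by (simp add: var_def bieval_single lookup_single when_def if_distrib[of "\<lambda>e. _ ^ e"] cong: if_cong)
  then have eval: "bieval (L i) u v = g i u $ q" for i u v
    by (simp add: L_def bieval_sum bieval_pscale matrix_vector_mult_def flip: matrix_works[OF lin])
  have "bieval (L i) (\<beta> k) v = (if i = k then 1 else 0)" if "i \<in> J" "k \<in> J" for i k v
    using assms(1) that by (auto simp: eval g inj_on_eq_iff)
  ultimately show ?thesis
    using that by blast
qed

lemma bieval_yvar: "bieval (yvar j) u v = v $ j"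
  by (simp add: yvar_def bieval_single lookup_single when_def if_distrib[of "\<lambda>e. _ ^ e"] cong: if_cong)

lemma yvar_in_bihom: "yvar j \<in> bihom 0 1"
  unfolding yvar_def by (rule single_in_bihom) (simp add: bidegree_def lookup_single when_def)

section \<open>The flattening and the ideal in bidegree (1, 1)\<close>

lemma bidegree_1_1:
  assumes "bidegree t = (1, 1)"
  obtains k j where "t = Poly_Mapping.single (Inl k) 1 + Poly_Mapping.single (Inr j) 1"
proof -
  have "(\<Sum>k\<in>UNIV. Poly_Mapping.lookup t (Inl k)) = 1" "(\<Sum>j\<in>UNIV. Poly_Mapping.lookup t (Inr j)) = 1"
    using assms by (auto simp: bidegree_def)
  then obtain k j where k: "Poly_Mapping.lookup t (Inl k) = 1"
      "\<And>k'. k' \<noteq> k \<Longrightarrow> Poly_Mapping.lookup t (Inl k') = 0"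
    and j: "Poly_Mapping.lookup t (Inr j) = 1" "\<And>j'. j' \<noteq> j \<Longrightarrow> Poly_Mapping.lookup t (Inr j') = 0"
    by (auto simp: sum_eq_Suc0_iff)
  have "t = Poly_Mapping.single (Inl k) 1 + Poly_Mapping.single (Inr j) 1"
  proof (rule poly_mapping_eqI)
    fix x show "Poly_Mapping.lookup t x =
        Poly_Mapping.lookup (Poly_Mapping.single (Inl k) 1 + Poly_Mapping.single (Inr j) 1) x"
      using k j by (cases x) (auto simp: lookup_add lookup_single when_def)
  qed
  then show ?thesis by (rule that)
qed

lemma flattening_add: "flattening A (f + g) = flattening A f + flattening A g"
  by (simp add: vec_eq_iff flattening_def lookup_add distrib_left sum.distrib)

lemma flattening_pscale: "flattening A (pscale c f) = c *s flattening A f"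
  by (simp add: vec_eq_iff flattening_def sum_distrib_left mult_ac)

lemma flattening_0 [simp]: "flattening A 0 = 0"
  by (simp add: vec_eq_iff flattening_def)

text \<open>Both sides are linear in \<open>f\<close>, so monomials \<open>x_k y_j\<close> suffice;
  there both sides are the sum of \<open>(\<beta> i $ k * \<gamma> i $ j) *s \<alpha> i\<close> over
  \<open>J\<close>.\<close>

lemma flattening_sum_outer:
  fixes \<alpha> :: "'i \<Rightarrow> complex ^ 'l::finite" and \<beta> :: "'i \<Rightarrow> complex ^ 'm::finite"
    and \<gamma> :: "'i \<Rightarrow> complex ^ 'n::finite"
  assumes "f \<in> bihom 1 1"
  shows "flattening (\<Sum>i\<in>J. outer (\<alpha> i) (\<beta> i) (\<gamma> i)) f = (\<Sum>i\<in>J. bieval f (\<beta> i) (\<gamma> i) *s \<alpha> i)"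
  using assms unfolding bihom_def
proof (rule pm.span_induct)
  show "pm.subspace {f. flattening (\<Sum>i\<in>J. outer (\<alpha> i) (\<beta> i) (\<gamma> i)) f = (\<Sum>i\<in>J. bieval f (\<beta> i) (\<gamma> i) *s \<alpha> i)}"
    by (intro pm.subspaceI)
      (simp_all add: flattening_add flattening_pscale bieval_add bieval_pscale
        vec.scale_left_distrib sum.distrib vec.scale_sum_right)
next
  fix f :: "('m, 'n) bipoly"
  assume "f \<in> {Poly_Mapping.single t 1 |t. bidegree t = (1, 1)}"
  then obtain k j where f: "f = Poly_Mapping.single (Poly_Mapping.single (Inl k) 1 + Poly_Mapping.single (Inr j) 1) 1"
    using bidegree_1_1 by blast
  \<comment> \<open>Distinct index pairs give distinct monomials, so the double sum in
    \<open>flattening A f\<close> keeps a single entry of \<open>A\<close>.\<close>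
  have inj: "Poly_Mapping.single (Inl k) 1 + Poly_Mapping.single (Inr j) (1 :: nat)
      = Poly_Mapping.single (Inl k') 1 + Poly_Mapping.single (Inr j') 1 \<longleftrightarrow> k' = k \<and> j' = j"
    (is "?t k j = ?t k' j' \<longleftrightarrow> _") for k' j'
  proof
    assume eq: "?t k j = ?t k' j'"
    then have "Poly_Mapping.lookup (?t k j) (Inl k) = Poly_Mapping.lookup (?t k' j') (Inl k)"
      and "Poly_Mapping.lookup (?t k j) (Inr j) = Poly_Mapping.lookup (?t k' j') (Inr j)"
      by simp_all
    then show "k' = k \<and> j' = j"
      by (simp_all add: lookup_add lookup_single when_def split: if_splits)
  qed simp
  have "flattening A f = (\<chi> i. A $ i $ k $ j)" for A :: "complex ^ 'n ^ 'm ^ 'l"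
  proof -
    have lookup: "Poly_Mapping.lookup f (Poly_Mapping.single (Inl k') 1 + Poly_Mapping.single (Inr j') 1)
        = (if k' = k \<and> j' = j then 1 else 0)" for k' j'
      by (simp only: f lookup_single when_def inj)
    have "(\<Sum>j'\<in>UNIV. a j' * (if k' = k \<and> j' = j then 1 else 0)) = (if k' = k then a j else 0)"
      for a :: "'n \<Rightarrow> complex" and k'
      by (cases "k' = k") (simp_all add: if_distrib[of "\<lambda>x. _ * x"] cong: if_cong)
    then show ?thesis
      unfolding flattening_def lookup by simp
  qed
  moreover have "bieval f u v = u $ k * v $ j" for u :: "complex ^ 'm" and v :: "complex ^ 'n"
    by (simp add: f bieval_single lookup_add lookup_single when_def if_distrib[of "\<lambda>e. _ ^ e"] cong: if_cong)
  ultimately show "flattening (\<Sum>i\<in>J. outer (\<alpha> i) (\<beta> i) (\<gamma> i)) f = (\<Sum>i\<in>J. bieval f (\<beta> i) (\<gamma> i) *s \<alpha> i)"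
    by (simp add: vec_eq_iff outer_def mult_ac)
qed

text \<open>Independence of the \<open>\<alpha> i\<close> turns \<open>flattening A f = 0\<close>
  into vanishing at every point. Vanishing survives multiplication by any polynomial, so passing to
  the generated ideal adds nothing in bidegree (1, 1).\<close>

lemma ideal_gen_flattening_ker_1_1:
  fixes \<alpha> :: "'i \<Rightarrow> complex ^ 'l::finite" and \<beta> :: "'i \<Rightarrow> complex ^ 'm::finite"
    and \<gamma> :: "'i \<Rightarrow> complex ^ 'n::finite"
  assumes "finite J" "inj_on \<alpha> J" "vec.independent (\<alpha> ` J)"
  shows "ideal_gen (flattening_ker (\<Sum>i\<in>J. outer (\<alpha> i) (\<beta> i) (\<gamma> i))) \<inter> bihom 1 1
    = {f \<in> bihom 1 1. \<forall>i\<in>J. bieval f (\<beta> i) (\<gamma> i) = 0}"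
    (is "ideal_gen (flattening_ker ?A) \<inter> _ = _")
proof -
  interpret S: module "(*) :: ('m, 'n) bipoly \<Rightarrow> _"
    by unfold_locales (auto simp: algebra_simps)
  have ker: "flattening_ker ?A = {f \<in> bihom 1 1. \<forall>i\<in>J. bieval f (\<beta> i) (\<gamma> i) = 0}"
    using vec.sum_family_eq_0[OF assms(2,3,1)]
    by (auto simp: flattening_ker_def flattening_sum_outer)
  have "ideal_gen (flattening_ker ?A) \<subseteq> {f. \<forall>i\<in>J. bieval f (\<beta> i) (\<gamma> i) = 0}"
    unfolding ideal_gen_def
    by (rule S.span_minimal) (auto simp: ker bieval_add bieval_times intro!: S.subspaceI)
  moreover have "flattening_ker ?A \<subseteq> ideal_gen (flattening_ker ?A)"
    unfolding ideal_gen_def by (rule S.span_superset)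
  ultimately show ?thesis
    unfolding ker by auto
qed

section \<open>The rank of \<open>N_tilde N h0\<close> and the spectrum of \<open>M\<close>\<close>

theorem theorem3p2:
  fixes l m n r :: nat
    and A :: "complex ^ 'n::finite ^ 'm::finite ^ 'l::finite"
    and \<alpha> :: "nat \<Rightarrow> complex ^ 'l"
    and \<beta> :: "nat \<Rightarrow> complex ^ 'm"
    and \<gamma> :: "nat \<Rightarrow> complex ^ 'n"
    and I :: "('m, 'n) bipoly set"
    and h0 :: "('m, 'n) bipoly"
    and N :: "('m, 'n) bipoly \<Rightarrow> (nat \<Rightarrow>\<^sub>0 complex)"
  assumes dims: "CARD('l) = l + 1" "CARD('m) = m + 1" "CARD('n) = n + 1"
    and order: "l \<ge> m" "m \<ge> n" "n > 0"
    and A_eq: "A = (\<Sum>i=1..r. outer (\<alpha> i) (\<beta> i) (\<gamma> i))"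
    and rank_A: "tensor_rank A = r"
    and r_le: "r \<le> min (l + 1) (m * n)"
    and I_def: "I = ideal_gen (flattening_ker A)"
    and generic_identifiable: "identifiable r A"
    and generic_rank: "vec.dim (flattening A ` bihom 1 1) = r"
    and generic_zeros: "zero_set I = (\<lambda>i. bipoint (\<beta> i) (\<gamma> i)) ` {1..r}"
    and generic_distinct: "inj_on (\<lambda>i. bipoint (\<beta> i) (\<gamma> i)) {1..r}"
    and generic_reduced: "\<forall>i\<in>{1..r}. reduced_at I (\<beta> i) (\<gamma> i)"
    and r_le': "r \<le> m + 1" "m + 1 \<le> l + 1"
    and rank_\<beta>: "vec.dim (\<beta> ` {1..r}) = r"
    and h0: "h0 \<in> bihom 0 1" "\<forall>i\<in>{1..r}. bieval h0 (\<beta> i) (\<gamma> i) \<noteq> 0"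
    and N: "pre_normal_form r I N"
  shows "rank_on (bihom 1 0) (N_tilde N h0) = r \<and>
    (\<forall>B j. pm.subspace B \<and> B \<subseteq> bihom 1 0 \<and> pm.dim B = r \<and>
        bij_betw (N_tilde N h0) B (cspace r) \<longrightarrow>
      (let M = inv_into B (N_tilde N h0) \<circ> N_tilde N (yvar j);
           ev = (\<lambda>i. \<gamma> i $ j / bieval h0 (\<beta> i) (\<gamma> i))
       in eigenvalues_on B M = ev ` {1..r} \<and>
          (\<forall>c. alg_mult_on B M c = card {i \<in> {1..r}. ev i = c})))"
proof -
  \<comment> \<open>Keeps the simplifier from rewriting the degrees in \<open>bihom 1 1\<close> and
    \<open>bihom 1 0\<close> to \<open>Suc 0\<close>.\<close>
  note One_nat_def [simp del]
  let ?J = "{1..r}"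
  let ?ev = "\<lambda>f i. bieval f (\<beta> i) (\<gamma> i)"
  \<comment> \<open>An image of dimension \<open>r\<close> inside the span of \<open>r\<close>
    vectors forces these to be independent.\<close>
  have "flattening A ` bihom 1 1 \<subseteq> vec.span (\<alpha> ` ?J)"
    by (auto simp: A_eq flattening_sum_outer vec.span_family)
  from vec.dim_subset[OF this] have "card ?J \<le> vec.dim (\<alpha> ` ?J)"
    by (simp add: generic_rank)
  then have \<alpha>: "inj_on \<alpha> ?J" "vec.independent (\<alpha> ` ?J)"
    using vec.family_independent_of_dim[of ?J \<alpha>] by auto
  have \<beta>: "inj_on \<beta> ?J" "vec.independent (\<beta> ` ?J)"
    using vec.family_independent_of_dim[of ?J \<beta>] rank_\<beta> by auto
  have I11: "I \<inter> bihom 1 1 = {f \<in> bihom 1 1. \<forall>i\<in>?J. ?ev f i = 0}"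
    unfolding I_def A_eq using \<alpha> by (intro ideal_gen_flattening_ker_1_1) auto
  from N have N_lin: "linear_map_on (bihom 1 1) (cspace r) N"
    and N_ker: "f \<in> bihom 1 1 \<Longrightarrow> N f = 0 \<longleftrightarrow> (\<forall>i\<in>?J. ?ev f i = 0)" for f
    unfolding pre_normal_form_def I11 by auto
  \<comment> \<open>\<open>N\<close> is linear only on \<open>bihom 1 1\<close>, so each partial sum
    must be shown to lie there; the empty and infinite cases use \<open>N 0 = 0\<close>.\<close>
  have N_sum: "N (\<Sum>i\<in>K. pscale (c i) (f i)) = (\<Sum>i\<in>K. pscale (c i) (N (f i)))"
    if "\<And>i. f i \<in> bihom 1 1" for c and f :: "nat \<Rightarrow> ('m, 'n) bipoly" and K
  proof (induction K rule: infinite_finite_induct)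
    case (insert i K)
    have "pscale (c i) (f i) \<in> bihom 1 1" "(\<Sum>i\<in>K. pscale (c i) (f i)) \<in> bihom 1 1"
      by (intro pm.subspace_sum pm.subspace_scale subspace_bihom that)+
    with insert N_lin that show ?case
      by (simp add: linear_map_on_def)
  qed (use N_ker[OF pm.subspace_0[OF subspace_bihom]] in auto)
  \<comment> \<open>By \<open>N_ker\<close>, the value of \<open>N\<close> on a (1, 1)-form depends
    only on the values of the form at the \<open>r\<close> points.\<close>
  have N_cong: "N f = N g" if "f \<in> bihom 1 1" "g \<in> bihom 1 1" "\<And>i. i \<in> ?J \<Longrightarrow> ?ev f i = ?ev g i" for f g
  proof -
    have mem: "f - g \<in> bihom 1 1"
      using that by (intro pm.subspace_diff subspace_bihom)
    moreover have "bieval (f - g) u v = bieval f u v - bieval g u v" for u v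
      using bieval_add[of "f - g" g] by simp
    ultimately have "N (f - g) = 0"
      using that by (simp add: N_ker)
    moreover have "N (f - g + g) = N (f - g) + N g"
      using N_lin mem that(2) unfolding linear_map_on_def by blast
    ultimately show ?thesis
      by simp
  qed
  obtain L :: "nat \<Rightarrow> ('m, 'n) bipoly" where L: "L i \<in> bihom 1 0"
    and ev_L: "i \<in> ?J \<Longrightarrow> k \<in> ?J \<Longrightarrow> ?ev (L i) k = (if i = k then 1 else 0)" for i k
    using dual_linear_forms[OF \<beta>] by metis
  have mult_in: "g * f \<in> bihom 1 1" if "g \<in> bihom 0 1" "f \<in> bihom 1 0" for f g :: "('m, 'n) bipoly"
    using bihom_times[OF that] by simp
  \<comment> \<open>The form \<open>h0 * L i\<close> vanishes at all of the points except the
    \<open>i\<close>-th, where its value is that of \<open>h0\<close>.\<close>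
  define w where "w i = N (h0 * L i)" for i
  \<comment> \<open>A relation among the \<open>w i\<close> yields a form in the kernel of
    \<open>N\<close>; its value at the \<open>i\<close>-th point is \<open>c i\<close> times the
    nonzero value of \<open>h0\<close>.\<close>
  have w_ind: "c i = 0" if "(\<Sum>i\<in>?J. pscale (c i) (w i)) = 0" "i \<in> ?J" for c i
  proof -
    have "N (\<Sum>i\<in>?J. pscale (c i) (h0 * L i)) = 0"
      using that(1) by (simp add: N_sum mult_in h0 L w_def)
    moreover have "(\<Sum>i\<in>?J. pscale (c i) (h0 * L i)) \<in> bihom 1 1"
      by (intro pm.subspace_sum pm.subspace_scale subspace_bihom mult_in h0 L)
    ultimately have "?ev (\<Sum>i\<in>?J. pscale (c i) (h0 * L i)) i = 0"
      using N_ker that(2) by blast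
    also have "?ev (\<Sum>i\<in>?J. pscale (c i) (h0 * L i)) i = c i * ?ev h0 i"
      using that(2) by (simp add: bieval_sum bieval_pscale bieval_times ev_L if_distrib[of "\<lambda>x. _ * x"] cong: if_cong)
    finally show ?thesis
      using h0 that(2) by auto
  qed
  \<comment> \<open>The division cancels the value of \<open>h0\<close> in \<open>h0 * L i\<close>,
    so the combination takes the same values as \<open>g * f\<close> at the points and
    \<open>N_cong\<close> applies.\<close>
  have N_tilde: "N_tilde N g f = (\<Sum>i\<in>?J. pscale (?ev f i * ?ev g i / ?ev h0 i) (w i))"
    if g: "g \<in> bihom 0 1" and f: "f \<in> bihom 1 0" for g f
  proof -
    let ?c = "\<lambda>i. ?ev f i * ?ev g i / ?ev h0 i"
    have "N (g * f) = N (\<Sum>i\<in>?J. pscale (?c i) (h0 * L i))"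
    proof (rule N_cong)
      show "(\<Sum>i\<in>?J. pscale (?c i) (h0 * L i)) \<in> bihom 1 1"
        by (intro pm.subspace_sum pm.subspace_scale subspace_bihom mult_in h0 L)
      fix k assume "k \<in> ?J"
      then show "?ev (g * f) k = ?ev (\<Sum>i\<in>?J. pscale (?c i) (h0 * L i)) k"
        using h0 by (simp add: bieval_sum bieval_pscale bieval_times ev_L if_distrib[of "\<lambda>x. _ * x"] cong: if_cong)
    qed (use mult_in f g in auto)
    then show ?thesis
      by (simp add: N_tilde_def N_sum mult_in h0 L w_def)
  qed
  have N_h0: "N_tilde N h0 f = (\<Sum>i\<in>?J. pscale (?ev f i) (w i))" if "f \<in> bihom 1 0" for f
    using N_tilde[OF h0(1) that] h0(2) by simp
  \<comment> \<open>Stated for any family dual to the points, as it serves both \<open>L\<close> and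
    the basis \<open>b\<close> of \<open>B\<close>.\<close>
  have ev_comb: "?ev (\<Sum>i\<in>?J. pscale (c i) (b i)) k = c k"
    if "k \<in> ?J" "\<And>i k. i \<in> ?J \<Longrightarrow> k \<in> ?J \<Longrightarrow> ?ev (b i) k = (if i = k then 1 else 0)"
    for b c k
    using that by (simp add: bieval_sum bieval_pscale if_distrib[of "\<lambda>x. _ * x"] cong: if_cong)
  have "N_tilde N h0 ` bihom 1 0 = pm.span (w ` ?J)"
    unfolding pm.span_family[OF finite_atLeastAtMost]
  proof (intro equalityI subsetI)
    fix x assume "x \<in> range (\<lambda>c. \<Sum>i\<in>?J. pscale (c i) (w i))"
    then obtain c where x: "x = (\<Sum>i\<in>?J. pscale (c i) (w i))" by auto
    have mem: "(\<Sum>i\<in>?J. pscale (c i) (L i)) \<in> bihom 1 0"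
      by (intro pm.subspace_sum pm.subspace_scale subspace_bihom L)
    then have "x = N_tilde N h0 (\<Sum>i\<in>?J. pscale (c i) (L i))"
      by (simp add: N_h0 x ev_comb[OF _ ev_L] del: atLeastAtMost_iff cong: sum.cong)
    then show "x \<in> N_tilde N h0 ` bihom 1 0"
      using mem by blast
  qed (auto simp: N_h0)
  then have rank: "rank_on (bihom 1 0) (N_tilde N h0) = r"
    using pm.dim_span_family[where f = w, OF finite_atLeastAtMost, of 1 r] w_ind
    by (simp add: rank_on_def del: atLeastAtMost_iff)
  moreover have "eigenvalues_on B M = ev ` ?J \<and> (\<forall>c. alg_mult_on B M c = card {i \<in> ?J. ev i = c})"
    if B: "pm.subspace B" "B \<subseteq> bihom 1 0" "bij_betw (N_tilde N h0) B (cspace r)"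
      and M: "M = inv_into B (N_tilde N h0) \<circ> N_tilde N (yvar j)"
      and ev: "ev = (\<lambda>i. \<gamma> i $ j / bieval h0 (\<beta> i) (\<gamma> i))"
    for B j M ev
  proof -
    have inj: "inj_on (N_tilde N h0) B"
      using B(3) by (simp add: bij_betw_def)
    have "w i \<in> cspace r" for i
      using N_lin by (simp add: w_def linear_map_on_def mult_in h0 L)
    then have "\<exists>b\<in>B. N_tilde N h0 b = w i" for i
      using B(3) by (metis bij_betw_imp_surj_on imageE)
    then obtain b where b: "b i \<in> B" "N_tilde N h0 (b i) = w i" for i
      by metis
    \<comment> \<open>Expanding \<open>N_tilde N h0 (b i) = w i\<close> by \<open>N_h0\<close> and
      comparing coefficients of the independent \<open>w k\<close> shows that \<open>b\<close> is
      dual to the points, just like \<open>L\<close>.\<close>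
    have ev_b: "?ev (b i) k = (if i = k then 1 else 0)" if "i \<in> ?J" "k \<in> ?J" for i k
    proof -
      have "(\<Sum>k\<in>?J. pscale (?ev (b i) k - (if k = i then 1 else 0)) (w k)) = 0"
        using b[of i] B(2) N_h0[of "b i"] that(1)
        by (simp add: pm.scale_left_diff_distrib sum_subtractf subset_iff
          if_distrib[of "\<lambda>x. pscale x _"] cong: if_cong)
      from w_ind[OF this that(2)] show ?thesis by auto
    qed
    let ?C = "\<lambda>c. \<Sum>i\<in>?J. pscale (c i) (b i)"
    have C_in: "?C c \<in> B" for c
      by (intro pm.subspace_sum pm.subspace_scale B b)
    \<comment> \<open>The combination of the \<open>b i\<close> weighted by the values of
      \<open>v\<close> has the same values as \<open>v\<close>, hence the same image under
      \<open>N_tilde N h0\<close>, which is injective on \<open>B\<close>.\<close>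
    have B_eq: "B = range ?C"
    proof (intro equalityI subsetI)
      fix v assume v: "v \<in> B"
      have "N_tilde N h0 v = N_tilde N h0 (?C (?ev v))"
        using v B(2) C_in[of "?ev v"] by (simp add: N_h0 subset_iff ev_comb[OF _ ev_b] del: atLeastAtMost_iff cong: sum.cong)
      then have "v = ?C (?ev v)"
        using inj v C_in by (auto dest: inj_onD)
      then show "v \<in> range ?C" by (intro image_eqI[of _ _ "?ev v"] UNIV_I)
    qed (use C_in in auto)
    have b_ind: "c i = 0" if "?C c = 0" "i \<in> ?J" for c i
      using ev_comb[OF that(2) ev_b, of c] that(1) by simp
    \<comment> \<open>Multiplication by \<open>yvar j\<close> in place of \<open>h0\<close> rescales
      the \<open>i\<close>-th coefficient by \<open>ev i\<close>. The resulting image comes from a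
      vector of \<open>B\<close>, which \<open>inv_into\<close> therefore returns.\<close>
    have M_C: "M (?C c) = ?C (\<lambda>i. ev i * c i)" for c
    proof -
      have "N_tilde N (yvar j) (?C c) = N_tilde N h0 (?C (\<lambda>i. ev i * c i))"
        using B(2) C_in
        by (simp add: N_h0 N_tilde yvar_in_bihom subset_iff
            ev_comb[OF _ ev_b] bieval_yvar ev mult.commute del: atLeastAtMost_iff cong: sum.cong)
      then show ?thesis
        using inv_into_f_f[OF inj C_in] by (simp add: M)
    qed
    show ?thesis
      by (intro conjI allI spectrum_diagonal[where b = b] finite_atLeastAtMost B_eq M_C) (rule b_ind; assumption)+
  qed
  ultimately show ?thesis
    unfolding Let_def by blast
qed

end
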